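(* Let $A=\mathbb{F}_q[t]$, where $q$ is a power of a prime $p$, let $d>1$ be an integer and let $c\in\mathbb{F}_q^*$. If $L_{d-1}+c$ and $[d]$ have a non-trivial greatest common divisor in $A$, then $p$ divides $d$.
   Context: For $n\ge 0$, $[n]:=t^{q^n}-t$. $L_0=1$ and $L_n=[n]L_{n-1}$ for $n\ge1$, so $L_{d-1}=[1][2]\cdots[d-1]$. *)

theory Defs
  imports "HOL-Computational_Algebra.Computational_Algebra" "HOL-Library.Cardinality"
begin

definition bracket :: "nat \<Rightarrow> nat \<Rightarrow> 'a::field poly" where
  "bracket q n = monom 1 (q ^ n) - monom 1 1"

primrec carlitz_L :: "nat \<Rightarrow> nat \<Rightarrow> 'a::field poly" where
  "carlitz_L q 0 = 1"
| "carlitz_L q (Suc n) = bracket q (Suc n) * carlitz_L q n"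

(* The constant gcd on 'a poly requires 'a to be of class field_gcd, which an arbitrary
   finite field type need not instantiate.  So that the base field stays arbitrary, greatest
   common divisors are given as a relation, determining g up to multiplication by units. *)
definition is_gcd :: "'a::comm_monoid_mult \<Rightarrow> 'a \<Rightarrow> 'a \<Rightarrow> bool" where
  "is_gcd g a b \<longleftrightarrow> g dvd a \<and> g dvd b \<and> (\<forall>h. h dvd a \<longrightarrow> h dvd b \<longrightarrow> h dvd g)"

end

(* A common root theta of the two polynomials in an algebraic closure satisfies
   theta^(q^d) = theta, and since L_(d-1)(theta) is nonzero, its conjugates theta^(q^i), i < d,
   are pairwise distinct.  Let F be the product of the x - theta^(q^i).  Up to sign, F'(theta) is
   L_(d-1)(theta) = -c, which is fixed by Frobenius, so F' takes the same value at all d conjugates.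
   As deg F' < d, F' is constant, so its coefficient d at x^(d-1) vanishes. *)

theory Submission
  imports Defs "HOL-Algebra.Algebraic_Closure_Type" "HOL-Number_Theory.Residues"
begin

hide_const (open) Divisibility.prime Polynomials.degree up_ring.coeff

lemma map_poly_to_ac_add: "map_poly to_ac (f + g) = map_poly to_ac f + map_poly to_ac g"
  by (intro poly_eqI) (simp add: coeff_map_poly)

lemma map_poly_to_ac_diff: "map_poly to_ac (f - g) = map_poly to_ac f - map_poly to_ac g"
  by (intro poly_eqI) (simp add: coeff_map_poly)

lemma map_poly_to_ac_mult: "map_poly to_ac (f * g) = map_poly to_ac f * map_poly to_ac g"
  by (intro poly_eqI) (simp add: coeff_map_poly coeff_mult to_ac_sum)

lemma nonunit_poly_has_root_alg_closure:
  fixes g :: "'a::field poly"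
  assumes "\<not> is_unit g"
  obtains z where "poly (map_poly to_ac g) z = 0"
proof (cases "g = 0")
  case False
  with assms have "degree (map_poly to_ac g) > 0"
    by (simp add: degree_map_poly is_unit_iff_degree)
  then show ?thesis
    using alg_closed_imp_poly_has_root that by blast
\<comment> \<open>The zero polynomial is also a nonunit, and every point is a root of it.\<close>
qed (use that[of 0] in simp)

lemma poly_bracket_to_ac:
  "poly (map_poly to_ac (bracket q n)) z = z ^ (q ^ n) - z"
  by (simp add: bracket_def map_poly_to_ac_diff map_poly_monom poly_monom)

lemma poly_carlitz_L_to_ac:
  "poly (map_poly to_ac (carlitz_L q n)) z = (\<Prod>i=1..n. z ^ (q ^ i) - z)"
  by (induction n) (simp_all add: map_poly_to_ac_mult poly_bracket_to_ac mult.commute)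

(* finite_field_power_card_eq_same needs the class finite_field, which a type of sort
   {field,finite} need not instantiate. *)
lemma power_CARD_eq_same:
  fixes x :: "'a::{field,finite}"
  shows "x ^ CARD('a) = x"
proof (cases "x = 0")
  case False
  have "bij_betw ((*) x) (UNIV - {0}) (UNIV - {0})"
    by (rule bij_betw_byWitness[where f' = "\<lambda>y. y / x"]) (use False in auto)
  then have "(\<Prod>y\<in>UNIV-{0}. x * y) = \<Prod>(UNIV - {0})"
    by (rule prod.reindex_bij_betw)
  \<comment> \<open>Cancel the product of all nonzero elements, which is itself nonzero.\<close>
  then have "x ^ (CARD('a) - 1) = 1"
    by (simp add: prod.distrib)
  then show ?thesis
    by (metis card_gt_0_iff UNIV_not_empty finite power_minus_mult mult_1)
qed simp

lemma CHAR_eq_prime_if_CARD_eq_power: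
  assumes "prime p" and "CARD('a::{field,finite}) = p ^ k"
  shows "CHAR('a) = p"
proof -
  have "prime CHAR('a)"
    by (simp add: finite_imp_CHAR_pos prime_CHAR_semidom)
  moreover have "CHAR('a) dvd p ^ k"
    using CHAR_dvd_CARD[where 'a = 'a] assms(2) by simp
  ultimately show ?thesis
    using assms(1) by (metis prime_dvd_power primes_dvd_imp_eq)
qed

text \<open>Applying the additive version to (x - y) + y avoids handling a sign (-1)^m.\<close>

lemma freshmans_dream_diff:
  fixes x y :: "'a::comm_ring_1"
  assumes "prime CHAR('a)" and "m = CHAR('a) ^ n"
  shows "(x - y) ^ m = x ^ m - y ^ m"
  using freshmans_dream'[OF assms, of "x - y" y] by (simp add: algebra_simps)

text \<open>With F the product of the x - b over \<open>S\<close>, the given products are the values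
  of F' on \<open>S\<close>, so F' - e has more roots than its degree allows unless it is zero. As
  \<open>card S > 1\<close>, the coefficient compared at the end has positive index, where the
  constant \<open>e\<close> contributes nothing.\<close>

lemma of_nat_card_eq_0_if_constant_difference_products:
  fixes S :: "'a::idom set"
  assumes "card S > 1" and const: "\<And>a. a \<in> S \<Longrightarrow> (\<Prod>b\<in>S - {a}. a - b) = e"
  shows "of_nat (card S) = (0 :: 'a)"
proof -
  \<comment> \<open>An infinite set has \<open>card\<close> 0.\<close>
  have fin: "finite S"
    using assms(1) card.infinite by fastforce
  define F where "F = (\<Prod>b\<in>S. [:-b, 1:])"
  have deg: "degree F = card S"
    unfolding F_def by (subst degree_prod_eq_sum_degree) auto
  have lead: "coeff F (card S) = 1"
    using lead_coeff_prod[of "\<lambda>b. [:-b, 1:]" S] deg by (simp add: F_def)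
  have "pderiv F = [:e:]"
  proof (rule poly_eqI_degree)
    fix a assume a: "a \<in> S"
    have "F = [:-a, 1:] * (\<Prod>b\<in>S - {a}. [:-b, 1:])"
      unfolding F_def using fin a by (rule prod.remove)
    \<comment> \<open>In the product rule, the term that keeps the factor x - a vanishes at
      \<open>a\<close>.\<close>
    then have "poly (pderiv F) a = (\<Prod>b\<in>S - {a}. a - b)"
      by (simp add: pderiv_mult pderiv_pCons poly_prod del: mult_pCons_left)
    then show "poly (pderiv F) a = poly [:e:] a"
      using const[OF a] by simp
  next
    \<comment> \<open>Only an upper bound: in positive characteristic differentiation can lower the
      degree by more than one.\<close>
    have "degree (pderiv F) \<le> card S - 1"
      by (rule degree_le) (auto simp: coeff_pderiv deg coeff_eq_0)
    then show "card S > degree (pderiv F)"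
      using assms(1) by linarith
  qed (use assms(1) in simp)
  then have "coeff (pderiv F) (card S - 1) = 0"
    using assms(1) by (simp add: coeff_pCons split: nat.split)
  then show ?thesis
    using lead assms(1) by (simp add: coeff_pderiv)
qed

text \<open>The differences are oriented oppositely to those in \<open>bracket\<close>, so that
  \<open>e\<close> is exactly F'(z); the sign is settled where the lemma is applied.\<close>

lemma of_nat_eq_0_if_difference_product_fixed:
  fixes z :: "'a::idom"
  assumes char: "prime CHAR('a)" and q: "q = CHAR('a) ^ k" and "d > 1"
    and z: "z ^ (q ^ d) = z"
    and e: "(\<Prod>i=1..d - 1. z - z ^ (q ^ i)) = e" "e \<noteq> 0" "e ^ q = e"
  shows "of_nat d = (0 :: 'a)"
proof -
  define \<theta> where "\<theta> i = z ^ (q ^ i)" for i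
  define S where "S = \<theta> ` {..<d}"
  have \<theta>_Suc: "\<theta> i ^ q = \<theta> (Suc i)" for i
    by (simp add: \<theta>_def mult.commute flip: power_mult)
  have frob_diff: "(x - y) ^ q = x ^ q - y ^ q" for x y :: 'a
    using char q by (rule freshmans_dream_diff)
  have "q > 0"
    using char q by (simp add: prime_gt_0_nat)
  have frob_inj: "inj (\<lambda>x :: 'a. x ^ q)"
    using frob_diff \<open>q > 0\<close> by (intro injI) (metis eq_iff_diff_eq_0 power_eq_0_iff)
  \<comment> \<open>By injectivity of Frobenius, a coincidence could be pulled back to
    \<open>i = 0\<close>, where it would make a factor of \<open>e\<close> vanish.\<close>
  have "\<theta> i \<noteq> \<theta> (i + m)" if "m \<in> {1..d - 1}" for i m
  proof (induction i)
    case 0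
    have "z - z ^ (q ^ m) \<noteq> 0"
      using e(1,2) that by (metis finite_atLeastAtMost prod_zero)
    then show ?case
      by (simp add: \<theta>_def)
  next
    case (Suc i)
    then show ?case
      using injD[OF frob_inj] by (metis \<theta>_Suc add_Suc)
  qed
  then have "\<theta> i \<noteq> \<theta> j" if "i < j" "j < d" for i j
    using that less_imp_add_positive[OF that(1)] by auto
  then have inj: "inj_on \<theta> {..<d}"
    by (metis inj_onI lessThan_iff linorder_neqE_nat)
  have card: "card S = d"
    unfolding S_def using inj by (simp add: card_image)
  have fin: "finite S"
    by (simp add: S_def)
  have frob_closed: "x ^ q \<in> S" if x: "x \<in> S" for x
  proof -
    obtain i where i: "i < d" "x = \<theta> i"
      using x by (auto simp: S_def)
    show ?thesis
    proof (cases "Suc i = d")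
      \<comment> \<open>The orbit closes up here because \<open>z ^ (q ^ d) = z\<close>.\<close>
      case True
      then have "x ^ q = \<theta> 0"
        using i \<theta>_Suc[of i] z by (simp add: \<theta>_def)
      then show ?thesis
        using \<open>d > 1\<close> by (auto simp: S_def)
    qed (use i \<theta>_Suc in \<open>auto simp: S_def\<close>)
  qed
  have frob_S: "(\<lambda>x. x ^ q) ` S = S"
    using fin frob_closed frob_inj by (intro endo_inj_surj) (auto intro: inj_on_subset)
  \<comment> \<open>Frobenius permutes \<open>S\<close> and carries the product at one conjugate to
    the product at the next, while fixing \<open>e\<close>. Letting \<open>i\<close> range over all
    naturals keeps the induction free of bounds.\<close>
  have const: "(\<Prod>b\<in>S - {\<theta> i}. \<theta> i - b) = e" for i
  proof (induction i)
    case 0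
    have "S - {\<theta> 0} = \<theta> ` ({..<d} - {0})"
      unfolding S_def using inj \<open>d > 1\<close> by (subst inj_on_image_set_diff[OF inj]) auto
    also have "{..<d} - {0} = {1..d - 1}"
      using \<open>d > 1\<close> by auto
    finally have "S - {\<theta> 0} = \<theta> ` {1..d - 1}" .
    moreover have "inj_on \<theta> {1..d - 1}"
      using \<open>d > 1\<close> by (intro inj_on_subset[OF inj]) auto
    ultimately have "(\<Prod>b\<in>S - {\<theta> 0}. \<theta> 0 - b) = (\<Prod>i=1..d - 1. \<theta> 0 - \<theta> i)"
      by (simp add: prod.reindex)
    then show ?case
      using e(1) by (simp add: \<theta>_def)
  next
    case (Suc i)
    have "S - {\<theta> (Suc i)} = (\<lambda>x. x ^ q) ` (S - {\<theta> i})"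
      using image_set_diff[OF frob_inj, of S "{\<theta> i}"] by (simp add: frob_S \<theta>_Suc)
    then have "(\<Prod>b\<in>S - {\<theta> (Suc i)}. \<theta> (Suc i) - b) = (\<Prod>b\<in>S - {\<theta> i}. \<theta> i ^ q - b ^ q)"
      using frob_inj by (simp add: prod.reindex inj_on_subset[OF frob_inj] \<theta>_Suc)
    also have "\<dots> = (\<Prod>b\<in>S - {\<theta> i}. \<theta> i - b) ^ q"
      by (simp add: frob_diff prod_power_distrib)
    finally show ?case
      using Suc e(3) by simp
  qed
  have "of_nat (card S) = (0 :: 'a)"
    by (rule of_nat_card_eq_0_if_constant_difference_products)
      (use \<open>d > 1\<close> card const in \<open>auto simp: S_def\<close>)
  then show ?thesis
    by (simp add: card)
qed

theorem theorem6:
  fixes c :: "'a::{field,finite}" and p k q d :: nat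
  assumes "prime p" and "q = p ^ k" and "CARD('a) = q"
    and "d > 1" and "c \<noteq> 0"
    and "\<exists>g :: 'a poly. is_gcd g (carlitz_L q (d - 1) + [:c:]) (bracket q d) \<and> \<not> is_unit g"
  shows "p dvd d"
proof -
  have char: "CHAR('a) = p"
    using assms(1-3) by (intro CHAR_eq_prime_if_CARD_eq_power) auto
  obtain g :: "'a poly" where g: "g dvd carlitz_L q (d - 1) + [:c:]" "g dvd bracket q d"
    and "\<not> is_unit g"
    using assms(6) by (auto simp: is_gcd_def)
  then obtain z where z: "poly (map_poly to_ac g) z = 0"
    using nonunit_poly_has_root_alg_closure by blast
  have root: "poly (map_poly to_ac f) z = 0" if "g dvd f" for f
    using that z by (auto simp: map_poly_to_ac_mult elim!: dvdE)
  have fixed: "z ^ (q ^ d) = z"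
    using root[OF g(2)] by (simp add: poly_bracket_to_ac)
  \<comment> \<open>The value of \<open>carlitz_L q (d - 1)\<close> at \<open>z\<close> is -c; the
    sign comes from reversing its d - 1 differences. Since \<open>a\<close> lies in the base field,
    the \<open>q\<close>-power map fixes it.\<close>
  define a where "a = (-1) ^ (d - 1) * (- c)"
  have "(\<Prod>i=1..d - 1. z ^ (q ^ i) - z) = to_ac (- c)"
    using root[OF g(1)]
    by (simp add: map_poly_to_ac_add poly_carlitz_L_to_ac map_poly_pCons eq_neg_iff_add_eq_0)
  moreover have "(\<Prod>i=1..d - 1. z - z ^ (q ^ i))
      = (-1) ^ (d - 1) * (\<Prod>i=1..d - 1. z ^ (q ^ i) - z)"
    using prod.distrib[of "\<lambda>_. -1" "\<lambda>i. z ^ (q ^ i) - z" "{1..d - 1}"] by simp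
  ultimately have "(\<Prod>i=1..d - 1. z - z ^ (q ^ i)) = to_ac a"
    by (simp add: a_def)
  moreover have "to_ac a \<noteq> 0"
    using \<open>c \<noteq> 0\<close> by (simp add: a_def)
  moreover have "to_ac a ^ q = to_ac a"
    using power_CARD_eq_same[of a] assms(3) by (simp flip: to_ac_power)
  ultimately have "of_nat d = (0 :: 'a alg_closure)"
    using assms(1,2,4) char fixed
    by (intro of_nat_eq_0_if_difference_product_fixed[of q k d z "to_ac a"]) auto
  \<comment> \<open>The algebraic closure has the same characteristic \<open>p\<close> as the base
    field.\<close>
  then show ?thesis
    by (simp add: of_nat_eq_0_iff_char_dvd char)
qed

end
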